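(* Let $V$ be a finite totally ordered set such that $|V|\geq 5$, and let $P$ be a partial pairing of $V$. The following assertions are equivalent. (1) The tournament $\mathrm{Inv}(\underline{V},P)$ is indecomposable. (2) The set $\cup P$ is a transversal of $\mathrm{mc}(\underline{V})$, and $P$ is an irreducible pairing of $\cup P$ (where $\cup P$ is totally ordered by the order induced from $V$).
   Context: All structures are finite. A tournament $T=(V(T),A(T))$ consists of a finite vertex set $V(T)$ and a set $A(T)$ of ordered pairs of distinct vertices (arcs) such that for all $x\neq y$ in $V(T)$, $(x,y)\in A(T)$ if and only if $(y,x)\notin A(T)$. For a totally ordered set $V$, $\underline{V}$ denotes the transitive tournament $(V,\{(x,y)\in V\times V: x<y\})$. For $P\subseteq \binom{V}{2}$ (a set of unordered pairs of distinct elements), $\mathrm{Inv}(\underline{V},P)$ is the tournament on $V$ obtained from $\underline{V}$ by reversing every arc $(x,y)$ such that $\{x,y\}\in P$; $\cup P$ denotes the union of the pairs in $P$. A module of a tournament $T$ is a subset $M\subseteq V(T)$ such that for every $v\in V(T)\setminus M$, either $\{v\}\times M\subseteq A(T)$ or $M\times\{v\}\subseteq A(T)$. The trivial modules are $\emptyset$, $V(T)$ and the singletons. $T$ is indecomposable if all its modules are trivial, and decomposable otherwise. A co-module of $T$ is a subset $M\subseteq V(T)$ such that $M$ or $V(T)\setminus M$ is a nontrivial module of $T$; it is minimal if it contains no other co-module. $\mathrm{mc}(T)$ denotes the family of minimal co-modules of $T$. A transversal of a family $\mathcal{F}$ of sets is a set $R$ with $R\cap F\neq\emptyset$ for every $F\in\mathcal{F}$.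 A pairing of a set $X$ is a partition of $X$ all of whose blocks have size $2$. A partial pairing of $V$ is a pairing of some subset of $V$ (namely of $\cup P$). An interval of a totally ordered set $X$ is a subset $I\subseteq X$ such that every element of $X\setminus I$ is greater than all the elements of $I$ or smaller than all of them; it is nontrivial if it is neither $\emptyset$, nor a singleton, nor $X$. A partition of a totally ordered set $X$ (in particular a pairing) is irreducible if no nontrivial interval of $X$ is a union of blocks. *)

theory Defs
  imports "Graph_Theory.Pair_Digraph" "HOL-Library.Disjoint_Sets"
begin

locale tournament = pair_digraph T for T :: "'a pair_pre_digraph" +
  assumes arc_iff: "\<lbrakk>x \<in> pverts T; y \<in> pverts T; x \<noteq> y\<rbrakk>
    \<Longrightarrow> (x, y) \<in> parcs T \<longleftrightarrow> (y, x) \<notin> parcs T"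

definition transitive_tournament :: "'a::linorder set \<Rightarrow> 'a pair_pre_digraph" where
  "transitive_tournament V = \<lparr>pverts = V, parcs = {(x, y) \<in> V \<times> V. x < y}\<rparr>"

definition Inv :: "'a pair_pre_digraph \<Rightarrow> 'a set set \<Rightarrow> 'a pair_pre_digraph" where
  "Inv T P = \<lparr>pverts = pverts T,
     parcs = {(x, y). (x, y) \<in> parcs T \<and> {x, y} \<notin> P} \<union>
             {(y, x) | x y. (x, y) \<in> parcs T \<and> {x, y} \<in> P}\<rparr>"

definition tournament_module :: "'a pair_pre_digraph \<Rightarrow> 'a set \<Rightarrow> bool" where
  "tournament_module T M \<longleftrightarrow> M \<subseteq> pverts T \<and>
     (\<forall>v \<in> pverts T - M. {v} \<times> M \<subseteq> parcs T \<or> M \<times> {v} \<subseteq> parcs T)"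

definition trivial_subset :: "'a set \<Rightarrow> 'a set \<Rightarrow> bool" where
  "trivial_subset X M \<longleftrightarrow> M = {} \<or> M = X \<or> (\<exists>x \<in> X. M = {x})"

definition indecomposable :: "'a pair_pre_digraph \<Rightarrow> bool" where
  "indecomposable T \<longleftrightarrow> (\<forall>M. tournament_module T M \<longrightarrow> trivial_subset (pverts T) M)"

definition nontrivial_module :: "'a pair_pre_digraph \<Rightarrow> 'a set \<Rightarrow> bool" where
  "nontrivial_module T M \<longleftrightarrow> tournament_module T M \<and> \<not> trivial_subset (pverts T) M"

definition co_module :: "'a pair_pre_digraph \<Rightarrow> 'a set \<Rightarrow> bool" where
  "co_module T M \<longleftrightarrow> M \<subseteq> pverts T \<and>
     (nontrivial_module T M \<or> nontrivial_module T (pverts T - M))"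

definition mc :: "'a pair_pre_digraph \<Rightarrow> 'a set set" where
  "mc T = {M. co_module T M \<and> (\<forall>N. co_module T N \<and> N \<subseteq> M \<longrightarrow> N = M)}"

definition transversal :: "'a set \<Rightarrow> 'a set set \<Rightarrow> bool" where
  "transversal R F \<longleftrightarrow> (\<forall>A \<in> F. R \<inter> A \<noteq> {})"

definition pairing :: "'a set \<Rightarrow> 'a set set \<Rightarrow> bool" where
  "pairing X P \<longleftrightarrow> partition_on X P \<and> (\<forall>B \<in> P. card B = 2)"

definition partial_pairing :: "'a set \<Rightarrow> 'a set set \<Rightarrow> bool" where
  "partial_pairing V P \<longleftrightarrow> (\<exists>X \<subseteq> V. pairing X P)"

text \<open>Intervals are taken relative to the set \<open>X\<close> with the order induced from the type,
  so they need not be intervals of the type itself.\<close>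

definition interval_of :: "'a::linorder set \<Rightarrow> 'a set \<Rightarrow> bool" where
  "interval_of X I \<longleftrightarrow> I \<subseteq> X \<and> (\<forall>x \<in> X - I. (\<forall>y \<in> I. y < x) \<or> (\<forall>y \<in> I. x < y))"

definition nontrivial_interval :: "'a::linorder set \<Rightarrow> 'a set \<Rightarrow> bool" where
  "nontrivial_interval X I \<longleftrightarrow> interval_of X I \<and> \<not> trivial_subset X I"

definition irreducible_partition :: "'a::linorder set \<Rightarrow> 'a set set \<Rightarrow> bool" where
  "irreducible_partition X P \<longleftrightarrow> partition_on X P \<and>
     \<not> (\<exists>I. nontrivial_interval X I \<and> (\<exists>Q \<subseteq> P. I = \<Union>Q))"

lemma tournament_transitive_tournament:
  assumes "finite V"
  shows "tournament (transitive_tournament V)"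
proof -
  have "finite {(x, y) \<in> V \<times> V. x < y}"
    by (rule finite_subset[of _ "V \<times> V"]) (use assms in auto)
  then show ?thesis
    using assms by unfold_locales (auto simp: transitive_tournament_def)
qed

lemma tournament_Inv:
  assumes "tournament T"
  shows "tournament (Inv T P)"
proof -
  interpret tournament T by fact
  have verts: "pverts (Inv T P) = pverts T"
    by (simp add: Inv_def)
  have arcs: "(x, y) \<in> parcs (Inv T P) \<longleftrightarrow>
      (if {x, y} \<in> P then (y, x) \<in> parcs T else (x, y) \<in> parcs T)" for x y
    by (simp add: Inv_def insert_commute)
  have sub: "parcs (Inv T P) \<subseteq> pverts T \<times> pverts T"
  proof (rule subrelI)
    fix x y assume "(x, y) \<in> parcs (Inv T P)"
    then have "(x, y) \<in> parcs T \<or> (y, x) \<in> parcs T"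
      by (simp add: arcs split: if_splits)
    then show "(x, y) \<in> pverts T \<times> pverts T"
      using in_arcsD1 in_arcsD2 by blast
  qed
  show ?thesis
  proof
    show "fst e \<in> pverts (Inv T P)" "snd e \<in> pverts (Inv T P)"
      if "e \<in> parcs (Inv T P)" for e
      using that sub by (auto simp: verts)
    show "finite (pverts (Inv T P))"
      by (simp add: verts)
    show "finite (parcs (Inv T P))"
      by (rule finite_subset[OF sub]) simp
    show "fst e \<noteq> snd e" if "e \<in> parcs (Inv T P)" for e
    proof
      assume "fst e = snd e"
      then have "(fst e, fst e) \<in> parcs T"
        using that by (cases e) (simp add: arcs)
      then show False
        using no_loops' by blast
    qed
    show "(x, y) \<in> parcs (Inv T P) \<longleftrightarrow> (y, x) \<notin> parcs (Inv T P)"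
      if "x \<in> pverts (Inv T P)" "y \<in> pverts (Inv T P)" "x \<noteq> y" for x y
      using arc_iff[of x y] that by (simp add: verts arcs insert_commute)
  qed
qed

end

(* A set of vertices that no pair of P crosses has the same arcs to its complement in V and in
   Inv(V, P), so intervals of V of this kind give modules of Inv(V, P). For the converse, let M be
   a nontrivial module of Inv(V, P). A vertex outside M that lies between elements of M must be
   matched with an extreme element of M and separate it from the rest of M. Hence the convex hull C
   of M is crossed by no pair. By irreducibility C misses the union of P, which contradicts
   transversality, or C contains it, so that C = V; then a vertex outside M and its partner form a
   nontrivial interval of the union of P. *)

theory Submission
  imports Defs
begin

section \<open>Modules, intervals and convex hulls\<close>

lemma nontrivial_subset_iff:
  assumes "M \<subseteq> X"
  shows "\<not> trivial_subset X M \<longleftrightarrow> M \<noteq> X \<and> (\<exists>a\<in>M. \<exists>b\<in>M. a \<noteq> b)"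
  using assms unfolding trivial_subset_def by blast

lemma pverts_simps [simp]:
  "pverts (transitive_tournament V) = V" "pverts (Inv T P) = pverts T"
  by (simp_all add: transitive_tournament_def Inv_def)

lemma parcs_Inv_transitive:
  "(x, y) \<in> parcs (Inv (transitive_tournament V) P) \<longleftrightarrow>
    x \<in> V \<and> y \<in> V \<and> (if {x, y} \<in> P then y < x else x < y)"
  by (auto simp: Inv_def transitive_tournament_def insert_commute)

lemma tournament_module_transitive_iff:
  "tournament_module (transitive_tournament V) M \<longleftrightarrow> interval_of V M"
  by (auto simp: tournament_module_def interval_of_def transitive_tournament_def)

lemma nontrivial_module_transitive_iff:
  "nontrivial_module (transitive_tournament V) M \<longleftrightarrow> nontrivial_interval V M"
  by (simp add: nontrivial_module_def nontrivial_interval_def tournament_module_transitive_iff)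

text \<open>The two disjuncts say that \<open>v\<close> dominates \<open>M\<close> and that
  \<open>M\<close> dominates \<open>v\<close>; the conditional flips the comparison exactly on
  reversed arcs.\<close>

lemma tournament_module_Inv_iff:
  "tournament_module (Inv (transitive_tournament V) P) M \<longleftrightarrow> M \<subseteq> V \<and>
    (\<forall>v\<in>V - M. (\<forall>y\<in>M. if {v, y} \<in> P then y < v else v < y) \<or>
      (\<forall>y\<in>M. if {v, y} \<in> P then v < y else y < v))"
proof -
  have "{v} \<times> M \<subseteq> parcs (Inv (transitive_tournament V) P) \<longleftrightarrow>
      (\<forall>y\<in>M. if {v, y} \<in> P then y < v else v < y)"
    and "M \<times> {v} \<subseteq> parcs (Inv (transitive_tournament V) P) \<longleftrightarrow>
      (\<forall>y\<in>M. if {v, y} \<in> P then v < y else y < v)"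
    if "M \<subseteq> V" "v \<in> V" for v
    using that by (auto simp: subset_iff parcs_Inv_transitive insert_commute)
  then show ?thesis
    unfolding tournament_module_def pverts_simps
    by (intro conj_cong ball_cong refl) (simp only: Diff_iff)
qed

text \<open>No reversed arc joins \<open>M\<close> to its complement, so every outside vertex sees
  \<open>M\<close> as it does in the transitive tournament.\<close>

lemma uncrossed_interval_module_Inv:
  assumes "interval_of V M" and "\<And>B. B \<in> P \<Longrightarrow> B \<subseteq> M \<or> B \<inter> M = {}"
  shows "tournament_module (Inv (transitive_tournament V) P) M"
proof -
  have "{v, y} \<notin> P" if "v \<notin> M" "y \<in> M" for v y
    using assms(2)[of "{v, y}"] that by auto
  then show ?thesis
    using assms(1) unfolding tournament_module_Inv_iff interval_of_def
    by (metis DiffD2)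
qed

lemma interval_of_hull:
  assumes "M \<subseteq> V"
  shows "interval_of V {v \<in> V. \<exists>a\<in>M. \<exists>b\<in>M. a \<le> v \<and> v \<le> b}"
  using assms unfolding interval_of_def
  by (smt (verit) Diff_iff dual_order.trans le_less_trans less_le_not_le linorder_le_cases
      mem_Collect_eq not_less subsetI)

section \<open>Co-modules and transversality\<close>

lemma co_module_contains_mc:
  assumes "finite (pverts T)" and "co_module T M"
  obtains N where "N \<in> mc T" and "N \<subseteq> M"
proof -
  have "finite {N. co_module T N}"
    by (rule finite_subset[of _ "Pow (pverts T)"]) (use assms in \<open>auto simp: co_module_def\<close>)
  then obtain N where "co_module T N" "N \<subseteq> M" "\<forall>K. co_module T K \<longrightarrow> K \<subseteq> N \<longrightarrow> N = K"
    using finite_has_minimal2[of "{N. co_module T N}" M] assms(2) by auto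
  then show thesis
    using that unfolding mc_def by blast
qed

text \<open>By finiteness every co-module contains a minimal one. Transversality can thus be tested
  on arbitrary co-modules, and \<open>mc\<close> of a transitive tournament need not be
  computed.\<close>

lemma transversal_mc_iff:
  assumes "finite (pverts T)"
  shows "transversal R (mc T) \<longleftrightarrow> (\<forall>M. co_module T M \<longrightarrow> R \<inter> M \<noteq> {})"
proof
  assume R: "transversal R (mc T)"
  show "\<forall>M. co_module T M \<longrightarrow> R \<inter> M \<noteq> {}"
  proof (intro allI impI)
    fix M assume "co_module T M"
    then obtain N where "N \<in> mc T" "N \<subseteq> M"
      using co_module_contains_mc assms by blast
    then show "R \<inter> M \<noteq> {}"
      using R unfolding transversal_def by blast
  qed
qed (auto simp: transversal_def mc_def)

lemma pairing_pairE:
  assumes "pairing X P" and "B \<in> P"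
  obtains x y where "B = {x, y}" and "x \<noteq> y"
  using assms unfolding pairing_def by (metis card_2_iff)

lemma pairing_partner_unique:
  assumes "pairing X P" and "{x, y} \<in> P" and "{x, z} \<in> P"
  shows "y = z"
proof -
  have "{x, y} = {x, z}"
    using assms disjointD[of P "{x, y}" "{x, z}"]
    unfolding pairing_def partition_on_def by auto
  then show ?thesis
    by (auto simp: doubleton_eq_iff)
qed

section \<open>From indecomposability to transversality and irreducibility\<close>

text \<open>If a co-module \<open>M\<close> misses every pair, then no pair crosses \<open>M\<close>
  or its complement; whichever of the two is a nontrivial interval stays a module after the
  inversion.\<close>

lemma indecomposable_Inv_imp_transversal:
  assumes "finite V" and "indecomposable (Inv (transitive_tournament V) P)" and "\<Union>P \<subseteq> V"
  shows "transversal (\<Union>P) (mc (transitive_tournament V))"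
proof -
  have False if M: "co_module (transitive_tournament V) M" "\<Union>P \<inter> M = {}" for M
  proof -
    obtain I where I: "nontrivial_interval V I" "I = M \<or> I = V - M"
      using M(1) unfolding co_module_def nontrivial_module_transitive_iff by auto
    have "tournament_module (Inv (transitive_tournament V) P) I"
      by (rule uncrossed_interval_module_Inv)
        (use I M(2) assms(3) in \<open>auto simp: nontrivial_interval_def\<close>)
    then show False
      using I(1) assms(2) by (auto simp: indecomposable_def nontrivial_interval_def)
  qed
  then show ?thesis
    using assms(1) by (subst transversal_mc_iff) auto
qed

text \<open>A nontrivial interval of \<open>\<Union>P\<close> that is a union of blocks is widened
  to its convex hull in \<open>V\<close>. The hull gains only unmatched vertices, so it is an
  uncrossed interval and a nontrivial module.\<close>

lemma indecomposable_Inv_imp_irreducible: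
  assumes "indecomposable (Inv (transitive_tournament V) P)"
    and "\<Union>P \<subseteq> V" and "partition_on (\<Union>P) P"
  shows "irreducible_partition (\<Union>P) P"
proof -
  have False if I: "nontrivial_interval (\<Union>P) I" and Q: "Q \<subseteq> P" "I = \<Union>Q" for I Q
  proof -
    define J where "J = {v \<in> V. \<exists>a\<in>I. \<exists>b\<in>I. a \<le> v \<and> v \<le> b}"
    have "I \<subseteq> \<Union>P"
      using Q by blast
    then obtain a b where ab: "a \<in> I" "b \<in> I" "a \<noteq> b" and "I \<noteq> \<Union>P"
      using I unfolding nontrivial_interval_def by (metis nontrivial_subset_iff)
    have "interval_of V J"
      unfolding J_def using \<open>I \<subseteq> \<Union>P\<close> assms(2) by (intro interval_of_hull) auto
    have J_Un: "J \<inter> \<Union>P = I"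
    proof
      show "J \<inter> \<Union>P \<subseteq> I"
      proof
        fix x assume x: "x \<in> J \<inter> \<Union>P"
        then obtain c d where "c \<in> I" "d \<in> I" "c \<le> x" "x \<le> d"
          unfolding J_def by blast
        then show "x \<in> I"
          using I x unfolding nontrivial_interval_def interval_of_def
          by (metis DiffI IntD2 leD)
      qed
      show "I \<subseteq> J \<inter> \<Union>P"
        using \<open>I \<subseteq> \<Union>P\<close> assms(2) unfolding J_def by auto
    qed
    \<comment> \<open>Blocks of \<open>Q\<close> lie in \<open>I\<close>. Any other block is
      disjoint from \<open>I\<close>, hence from \<open>J\<close>, which has no further matched
      vertices.\<close>
    have "B \<subseteq> J \<or> B \<inter> J = {}" if "B \<in> P" for B
    proof (cases "B \<in> Q")
      case True
      then show ?thesis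
        using Q J_Un by blast
    next
      case False
      then have "B \<inter> I = {}"
        using that Q assms(3) disjointD[of P B] unfolding partition_on_def
      by (metis Int_commute Sup_inf_eq_bot_iff subset_iff)
      then show ?thesis
        using J_Un that by blast
    qed
    then have "tournament_module (Inv (transitive_tournament V) P) J"
      using \<open>interval_of V J\<close> uncrossed_interval_module_Inv by blast
    then have "trivial_subset V J"
      using assms(1) unfolding indecomposable_def by auto
    moreover have "J \<subseteq> V"
      unfolding J_def by blast
    moreover have "J \<noteq> V" "a \<in> J" "b \<in> J"
      using J_Un ab \<open>I \<noteq> \<Union>P\<close> assms(2) by blast+
    ultimately show False
      using ab(3) nontrivial_subset_iff by metis
  qed
  then show ?thesis
    using assms(3) unfolding irreducible_partition_def by blast
qed

section \<open>From transversality and irreducibility to indecomposability\<close>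

text \<open>All arcs between \<open>v\<close> and \<open>M\<close> point the same way, and at most
  one of them, the arc to the partner of \<open>v\<close>, is reversed. So the partner alone lies on
  the other side of \<open>v\<close>.\<close>

lemma module_Inv_separation:
  assumes "pairing X P" and M: "tournament_module (Inv (transitive_tournament V) P) M"
    and v: "v \<in> V" "v \<notin> M"
  shows "(\<forall>y\<in>M. {v, y} \<notin> P) \<Longrightarrow> (\<forall>y\<in>M. v < y) \<or> (\<forall>y\<in>M. y < v)"
    and "\<lbrakk>p \<in> M; {v, p} \<in> P\<rbrakk> \<Longrightarrow>
      (p < v \<and> (\<forall>y\<in>M - {p}. v < y)) \<or> (v < p \<and> (\<forall>y\<in>M - {p}. y < v))"
proof -
  have sep: "(\<forall>y\<in>M. if {v, y} \<in> P then y < v else v < y) \<or>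
      (\<forall>y\<in>M. if {v, y} \<in> P then v < y else y < v)"
    using M v unfolding tournament_module_Inv_iff by blast
  show "(\<forall>y\<in>M. {v, y} \<notin> P) \<Longrightarrow> (\<forall>y\<in>M. v < y) \<or> (\<forall>y\<in>M. y < v)"
    using sep by simp
  assume p: "p \<in> M" "{v, p} \<in> P"
  then have "{v, y} \<notin> P" if "y \<in> M - {p}" for y
    using that pairing_partner_unique[OF assms(1)] by blast
  then show "(p < v \<and> (\<forall>y\<in>M - {p}. v < y)) \<or> (v < p \<and> (\<forall>y\<in>M - {p}. y < v))"
    using sep p by (metis DiffD1)
qed

lemma transversal_irreducible_imp_indecomposable:
  assumes fin: "finite V" and card: "card V \<ge> 5" and PV: "\<Union>P \<subseteq> V"
    and trans: "transversal (\<Union>P) (mc (transitive_tournament V))"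
    and pair: "pairing (\<Union>P) P" and irr: "irreducible_partition (\<Union>P) P"
  shows "indecomposable (Inv (transitive_tournament V) P)"
proof (rule ccontr)
  assume "\<not> ?thesis"
  then obtain M where M: "tournament_module (Inv (transitive_tournament V) P) M"
    and nontriv: "\<not> trivial_subset V M"
    unfolding indecomposable_def by auto
  have MV: "M \<subseteq> V"
    using M by (simp add: tournament_module_Inv_iff)
  obtain m1 m2 where m: "m1 \<in> M" "m2 \<in> M" "m1 \<noteq> m2" and "M \<noteq> V"
    using nontriv nontrivial_subset_iff[OF MV] by blast
  have other: "\<exists>q\<in>M. q \<noteq> p" for p
    using m by metis
  note sep = module_Inv_separation[OF pair M]
  have irrD: False if "nontrivial_interval (\<Union>P) I" "Q \<subseteq> P" "I = \<Union>Q" for I Q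
    using irr that unfolding irreducible_partition_def by blast
  have hit: "\<Union>P \<inter> N \<noteq> {}" if "co_module (transitive_tournament V) N" for N
    using trans that fin by (simp add: transversal_mc_iff)
  have ne: "V \<noteq> {}"
    using m MV by blast
  \<comment> \<open>Removing an extreme vertex leaves a nontrivial interval, so the singleton is a
    co-module and must be hit.\<close>
  have ends: "x \<in> \<Union>P" if x: "x \<in> V" and ext: "(\<forall>y\<in>V. x \<le> y) \<or> (\<forall>y\<in>V. y \<le> x)" for x
  proof -
    have "card (V - {x}) \<ge> 2"
      using card x fin by simp
    then obtain S where S: "S \<subseteq> V - {x}" "card S = 2"
      by (rule obtain_subset_with_card_n)
    then obtain y z where "S = {y, z}" "y \<noteq> z"
      by (meson card_2_iff)
    then have "\<not> trivial_subset V (V - {x})"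
      using x S(1) by (subst nontrivial_subset_iff) auto
    moreover have "interval_of V (V - {x})"
      using ext unfolding interval_of_def by (auto simp: order_le_less)
    ultimately have "co_module (transitive_tournament V) {x}"
      using x by (simp add: co_module_def nontrivial_module_transitive_iff nontrivial_interval_def)
    then show ?thesis
      using hit by blast
  qed

  define C where "C = {v \<in> V. \<exists>a\<in>M. \<exists>b\<in>M. a \<le> v \<and> v \<le> b}"
  have C_int: "interval_of V C"
    unfolding C_def by (rule interval_of_hull[OF MV])
  have CV: "C \<subseteq> V"
    unfolding C_def by blast
  have MC: "M \<subseteq> C"
    using MV unfolding C_def by auto
  have partner: "\<exists>p\<in>M. {v, p} \<in> P" if v: "v \<in> C" "v \<notin> M" for v
  proof (rule ccontr)
    assume "\<not> ?thesis"
    then have "(\<forall>y\<in>M. v < y) \<or> (\<forall>y\<in>M. y < v)"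
      using sep(1)[of v] v unfolding C_def by blast
    then show False
      using v unfolding C_def by (auto simp: not_le[symmetric])
  qed
  have closed: "y \<in> C" if xy: "{x, y} \<in> P" "x \<in> C" for x y
  proof (cases "y \<in> M")
    case True
    then show ?thesis
      using MC by blast
  next
    case y: False
    have "y \<in> V"
      using xy PV by blast
    \<comment> \<open>Otherwise the partner of \<open>x\<close>, which is \<open>y\<close>, would
      lie in \<open>M\<close>.\<close>
    have "x \<in> M"
      using partner[of x] xy y pairing_partner_unique[OF pair] by metis
    moreover obtain q where "q \<in> M" "q \<noteq> x"
      using other by blast
    \<comment> \<open>The vertex \<open>y\<close> separates its partner \<open>x\<close> from
      \<open>q\<close>, so it lies between two elements of \<open>M\<close>.\<close>
    ultimately have "x < y \<and> y < q \<or> q < y \<and> y < x"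
      using sep(2)[OF \<open>y \<in> V\<close> y, of x] xy by (auto simp: insert_commute)
    then show ?thesis
      unfolding C_def using \<open>x \<in> M\<close> \<open>q \<in> M\<close> \<open>y \<in> V\<close> by (auto intro: less_imp_le)
  qed
  have uncrossed: "B \<subseteq> C" if "B \<in> P" "B \<inter> C \<noteq> {}" for B
  proof -
    obtain x y where "B = {x, y}"
      using pairing_pairE[OF pair \<open>B \<in> P\<close>] .
    then show ?thesis
      using closed[of x y] closed[of y x] that by (auto simp: insert_commute)
  qed
  have C_Un: "C \<inter> \<Union>P = \<Union>{B \<in> P. B \<subseteq> C}"
    using uncrossed by blast
  have "interval_of (\<Union>P) (C \<inter> \<Union>P)"
    using C_int PV unfolding interval_of_def by blast
  then have "trivial_subset (\<Union>P) (C \<inter> \<Union>P)"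
    using irrD[of "C \<inter> \<Union>P" "{B \<in> P. B \<subseteq> C}"] C_Un unfolding nontrivial_interval_def by auto
  then consider (disj) "C \<inter> \<Union>P = {}" | (all) "\<Union>P \<subseteq> C" | (single) x where "C \<inter> \<Union>P = {x}"
    unfolding trivial_subset_def by blast
  then show False
  proof cases
    case disj
    have "Min V \<in> \<Union>P"
      using ends[of "Min V"] fin ne by simp
    then have "C \<noteq> V"
      using disj Min_in[OF fin ne] by blast
    then have "\<not> trivial_subset V C"
      using m MC nontrivial_subset_iff[OF CV] by blast
    then have "co_module (transitive_tournament V) C"
      using C_int CV
      by (simp add: co_module_def nontrivial_module_transitive_iff nontrivial_interval_def)
    then show False
      using hit disj by blast
  next
    case single
    then obtain B where "B \<in> P" "x \<in> B"
      by blast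
    then have "B \<subseteq> {x}"
      using uncrossed[of B] single by blast
    moreover obtain y z where "B = {y, z}" "y \<noteq> z"
      using pairing_pairE[OF pair \<open>B \<in> P\<close>] .
    ultimately show False
      by auto
  next
    case all
    have min_max: "Min V \<in> \<Union>P" "Max V \<in> \<Union>P"
      using ends[of "Min V"] ends[of "Max V"] fin ne by simp_all
    \<comment> \<open>The interval \<open>C\<close> contains both extreme vertices of
      \<open>V\<close>, as these are matched.\<close>
    have "v \<in> C" if "v \<in> V" for v
    proof (rule ccontr)
      assume "v \<notin> C"
      then have "(\<forall>y\<in>C. y < v) \<or> (\<forall>y\<in>C. v < y)"
        using C_int that unfolding interval_of_def by blast
      moreover have "Min V \<le> v" "v \<le> Max V"
        using fin that by simp_all
      ultimately show False
        using all min_max by (meson leD subsetD)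
    qed
    then have "C = V"
      using CV by blast
    obtain v where v: "v \<in> V" "v \<notin> M"
      using MV \<open>M \<noteq> V\<close> by blast
    then obtain p where p: "p \<in> M" "{v, p} \<in> P"
      using partner \<open>C = V\<close> by blast
    \<comment> \<open>Here the bound 5 enters: taking partners injects \<open>V - M\<close> into
      \<open>M\<close>, so at most two elements in \<open>M\<close> would give at most four in
      \<open>V\<close>.\<close>
    have third: "\<exists>r\<in>M. r \<noteq> p \<and> r \<noteq> q" for q
    proof (rule ccontr)
      assume "\<not> ?thesis"
      then have "M \<subseteq> {p, q}"
        by blast
      obtain f where f: "\<And>x. x \<in> V - M \<Longrightarrow> f x \<in> M \<and> {x, f x} \<in> P"
        using partner \<open>C = V\<close> by (metis DiffE)
      have "inj_on f (V - M)"
      proof (rule inj_onI)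
        fix x y assume "x \<in> V - M" "y \<in> V - M" "f x = f y"
        then have "{f x, x} \<in> P" "{f x, y} \<in> P"
          using f[of x] f[of y] by (simp_all add: insert_commute)
        then show "x = y"
          by (rule pairing_partner_unique[OF pair])
      qed
      moreover have "f ` (V - M) \<subseteq> M"
        using f by blast
      ultimately have "card (V - M) \<le> card M"
        using finite_subset[OF MV fin] by (rule card_inj_on_le)
      moreover have "card M \<le> 2"
        using card_mono[OF _ \<open>M \<subseteq> {p, q}\<close>] by (simp add: card_insert_if split: if_splits)
      moreover have "card V = card M + card (V - M)"
        using card_Diff_subset[OF finite_subset[OF MV fin] MV] card_mono[OF fin MV] by simp
      ultimately show False
        using card by linarith
    qed
    \<comment> \<open>Since \<open>v\<close> separates \<open>p\<close> from the rest of
      \<open>M\<close>, such a \<open>u\<close> is outside \<open>M\<close> and has a partner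
      \<open>q\<close> in \<open>M\<close> other than \<open>p\<close>. For a third element
      \<open>r\<close> of \<open>M\<close>, the vertex \<open>u\<close> has \<open>r\<close> and
      \<open>p\<close> on the same side, whereas \<open>v\<close> has \<open>r\<close> on the side
      away from \<open>p\<close>, hence so does \<open>u\<close>.\<close>
    have between: False if u: "u \<in> V" "v < u \<and> u < p \<or> p < u \<and> u < v" for u
    proof -
      note sv = sep(2)[OF v p]
      have "u \<notin> M"
      proof
        assume "u \<in> M"
        then have "u \<in> M - {p}"
          using u(2) by auto
        then have "p < v \<and> v < u \<or> v < p \<and> u < v"
          using sv by blast
        then show False
          using u(2) by auto
      qed
      then obtain q where q: "q \<in> M" "{u, q} \<in> P"
        using partner u \<open>C = V\<close> by blast
      have "q \<noteq> p"
        using pairing_partner_unique[OF pair, of p u v] p q u(2) by (auto simp: insert_commute)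
      obtain r where r: "r \<in> M" "r \<noteq> p" "r \<noteq> q"
        using third by blast
      have "(q < u \<and> r > u \<and> p > u) \<or> (u < q \<and> r < u \<and> p < u)"
        using sep(2)[OF u(1) \<open>u \<notin> M\<close> q] r p \<open>q \<noteq> p\<close> by auto
      moreover have "(p < v \<and> q > v \<and> r > v) \<or> (v < p \<and> q < v \<and> r < v)"
        using sv r q \<open>q \<noteq> p\<close> by auto
      ultimately show False
        using u(2) by auto
    qed
    have "v \<noteq> p"
      using v p by blast
    have "interval_of (\<Union>P) {v, p}"
    proof -
      have "(v < u \<and> p < u) \<or> (u < v \<and> u < p)" if "u \<in> \<Union>P - {v, p}" for u
        using between[of u] that PV by (metis Diff_iff insertCI linorder_less_linear subsetD)
      then show ?thesis
        using p(2) unfolding interval_of_def by auto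
    qed
    moreover have "\<not> trivial_subset (\<Union>P) {v, p}"
    proof -
      \<comment> \<open>If equality held, \<open>v\<close> and \<open>p\<close> would be the only
        candidates for the extreme vertices of \<open>V\<close>, yet another element of
        \<open>M\<close> lies beyond \<open>v\<close> as seen from \<open>p\<close>.\<close>
      have "{v, p} \<noteq> \<Union>P"
      proof
        assume eq: "{v, p} = \<Union>P"
        obtain r where "r \<in> M" "r \<noteq> p"
          using other by blast
        then have "p < v \<and> v < r \<or> v < p \<and> r < v"
          using sep(2)[OF v p] by blast
        moreover have "Min V \<le> r" "r \<le> Max V"
          using fin \<open>r \<in> M\<close> MV by auto
        moreover have "Min V \<in> {v, p}" "Max V \<in> {v, p}"
          using min_max unfolding eq by simp_all
        ultimately show False
          by auto
      qed
      then show ?thesis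
        using p(2) \<open>v \<noteq> p\<close> by (subst nontrivial_subset_iff) auto
    qed
    ultimately show False
      using irrD[of "{v, p}" "{{v, p}}"] p(2) unfolding nontrivial_interval_def by auto
  qed
qed

theorem theorem3p1:
  fixes V :: "'a::linorder set" and P :: "'a set set"
  assumes "finite V" and "card V \<ge> 5" and "partial_pairing V P"
  shows "indecomposable (Inv (transitive_tournament V) P) \<longleftrightarrow>
    transversal (\<Union>P) (mc (transitive_tournament V)) \<and>
    pairing (\<Union>P) P \<and> irreducible_partition (\<Union>P) P"
proof -
  obtain X where X: "X \<subseteq> V" "pairing X P"
    using assms(3) unfolding partial_pairing_def by blast
  then have "\<Union>P = X" and "partition_on X P"
    unfolding pairing_def partition_on_def by auto
  then show ?thesis
    using X assms(1,2) indecomposable_Inv_imp_transversal indecomposable_Inv_imp_irreducible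
      transversal_irreducible_imp_indecomposable by metis
qed

end
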